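(* Let $\alpha>0$ and let $\Lambda\subset\mathbb{R}^3$ be a simply connected open domain contained in $\{x_2>0\}$. Let $h=h(x_0,x_1,x_2)$ be an $\alpha$-hyperbolic harmonic potential in $\Lambda$. Then $h$ is an $\alpha$-axial-hyperbolic harmonic potential in $\Lambda$ if and only if, in cylindrical coordinates $(x_0,\theta,\rho)$, $$\frac{\partial h}{\partial\theta}=0\quad\text{in }\Lambda.$$
   Context: Here $\mathbb{R}^3=\{(x_0,x_1,x_2)\}$, $\Delta$ is the Euclidean Laplacian, and cylindrical coordinates are given by $x_1=\rho\cos\theta$, $x_2=\rho\sin\theta$, $\rho=\sqrt{x_1^2+x_2^2}$. For $\alpha>0$, a real-valued $C^2$ function $h$ on a simply connected open domain $\Lambda\subset\{x_2>0\}$ is called an $\alpha$-hyperbolic harmonic potential in $\Lambda$ if it satisfies $x_2\Delta h-\alpha\,\frac{\partial h}{\partial x_2}=0$ in $\Lambda$. A real-valued $C^2$ function $h$ on a simply connected open domain $\Lambda\subset\{\rho>0\}$ is called an $\alpha$-axial-hyperbolic harmonic potential in $\Lambda$ if it satisfies $(x_1^2+x_2^2)\Delta h-\alpha\left(x_1\frac{\partial h}{\partial x_1}+x_2\frac{\partial h}{\partial x_2}\right)=0$ in $\Lambda$. *)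

theory Defs
  imports "HOL-Analysis.Analysis"
begin

text \<open>
  The coordinates \<open>(x\<^sub>0, x\<^sub>1, x\<^sub>2)\<close> of a point \<open>x :: real ^ 3\<close> are written \<open>x $ 0\<close>, \<open>x $ 1\<close>,
  \<open>x $ 2\<close>. Arithmetic in the index type \<open>3\<close> is modulo 3, so \<open>0\<close>, \<open>1\<close>, \<open>2\<close> are its three elements
  and \<open>x $ 0\<close> is the component that the library usually writes \<open>x $ 3\<close>.
\<close>

definition partial_deriv :: "3 \<Rightarrow> (real ^ 3 \<Rightarrow> real) \<Rightarrow> real ^ 3 \<Rightarrow> real" where
  "partial_deriv i f x = deriv (\<lambda>t. f (x + t *\<^sub>R axis i 1)) 0"

definition laplacian :: "(real ^ 3 \<Rightarrow> real) \<Rightarrow> real ^ 3 \<Rightarrow> real" where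
  "laplacian f x = (\<Sum>i\<in>UNIV. partial_deriv i (partial_deriv i f) x)"

text \<open>The next two definitions are meant for open sets \<open>S\<close> only.\<close>

definition C1_on :: "(real ^ 3) set \<Rightarrow> (real ^ 3 \<Rightarrow> real) \<Rightarrow> bool" where
  "C1_on S f \<longleftrightarrow> f differentiable_on S \<and> (\<forall>i. continuous_on S (partial_deriv i f))"

definition C2_on :: "(real ^ 3) set \<Rightarrow> (real ^ 3 \<Rightarrow> real) \<Rightarrow> bool" where
  "C2_on S f \<longleftrightarrow> C1_on S f \<and> (\<forall>i. C1_on S (partial_deriv i f))"

definition hyperbolic_harmonic_potential ::
  "real \<Rightarrow> (real ^ 3) set \<Rightarrow> (real ^ 3 \<Rightarrow> real) \<Rightarrow> bool" where
  "hyperbolic_harmonic_potential \<alpha> \<Lambda> h \<longleftrightarrow>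
     \<alpha> > 0 \<and> open \<Lambda> \<and> simply_connected \<Lambda> \<and> \<Lambda> \<subseteq> {x. x $ 2 > 0} \<and> C2_on \<Lambda> h \<and>
     (\<forall>x\<in>\<Lambda>. x $ 2 * laplacian h x - \<alpha> * partial_deriv 2 h x = 0)"

definition axial_radius :: "real ^ 3 \<Rightarrow> real" where
  "axial_radius x = sqrt ((x $ 1)\<^sup>2 + (x $ 2)\<^sup>2)"

definition axial_hyperbolic_harmonic_potential ::
  "real \<Rightarrow> (real ^ 3) set \<Rightarrow> (real ^ 3 \<Rightarrow> real) \<Rightarrow> bool" where
  "axial_hyperbolic_harmonic_potential \<alpha> \<Lambda> h \<longleftrightarrow>
     \<alpha> > 0 \<and> open \<Lambda> \<and> simply_connected \<Lambda> \<and> \<Lambda> \<subseteq> {x. axial_radius x > 0} \<and> C2_on \<Lambda> h \<and>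
     (\<forall>x\<in>\<Lambda>. ((x $ 1)\<^sup>2 + (x $ 2)\<^sup>2) * laplacian h x
        - \<alpha> * (x $ 1 * partial_deriv 1 h x + x $ 2 * partial_deriv 2 h x) = 0)"

definition cylindrical_point :: "real \<Rightarrow> real \<Rightarrow> real \<Rightarrow> real ^ 3" where
  "cylindrical_point x\<^sub>0 \<theta> \<rho> =
     (\<chi> i. if i = 0 then x\<^sub>0 else if i = 1 then \<rho> * cos \<theta> else \<rho> * sin \<theta>)"

lemma cylindrical_point_nth [simp]:
  "cylindrical_point x\<^sub>0 \<theta> \<rho> $ 0 = x\<^sub>0"
  "cylindrical_point x\<^sub>0 \<theta> \<rho> $ 1 = \<rho> * cos \<theta>"
  "cylindrical_point x\<^sub>0 \<theta> \<rho> $ 2 = \<rho> * sin \<theta>"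
  by (simp_all add: cylindrical_point_def)

definition angular_deriv :: "(real ^ 3 \<Rightarrow> real) \<Rightarrow> real \<Rightarrow> real \<Rightarrow> real \<Rightarrow> real" where
  "angular_deriv h x\<^sub>0 \<theta> \<rho> = deriv (\<lambda>t. h (cylindrical_point x\<^sub>0 t \<rho>)) \<theta>"

end

theory Submission
  imports Defs
begin

text \<open>
  Multiplying the axial equation by \<open>x\<^sub>2 > 0\<close> and eliminating the Laplacian with the hyperbolic
  equation leaves \<open>\<alpha> x\<^sub>1 (x\<^sub>1 \<partial>h/\<partial>x\<^sub>2 - x\<^sub>2 \<partial>h/\<partial>x\<^sub>1) = 0\<close>, that is \<open>x\<^sub>1 \<partial>h/\<partial>\<theta> = 0\<close>. Hence
  \<open>\<partial>h/\<partial>\<theta>\<close> vanishes off the plane \<open>x\<^sub>1 = 0\<close>, and by continuity on it.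
\<close>

text \<open>Chain rule along the line through \<open>x\<close> in direction \<open>axis i 1\<close>.
  It ties the one-variable \<open>deriv\<close> to the linear map \<open>D\<close>, so that partial
  derivatives can be combined by linearity.\<close>

lemma partial_deriv_eq_derivative:
  assumes "(f has_derivative D) (at x)"
  shows "partial_deriv i f x = D (axis i 1)"
proof -
  have "((\<lambda>t. x + t *\<^sub>R axis i 1) has_derivative (\<lambda>t. t *\<^sub>R axis i 1)) (at (0::real))"
    by (auto intro!: derivative_eq_intros)
  then have "((\<lambda>t. f (x + t *\<^sub>R axis i 1)) has_derivative (\<lambda>t. D (t *\<^sub>R axis i 1))) (at 0)"
    by (rule has_derivative_compose) (use assms in simp)
  moreover have "D (t *\<^sub>R axis i 1) = D (axis i 1) * t" for t
    using has_derivative_linear[OF assms] by (simp add: linear_cmul mult.commute)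
  ultimately show ?thesis
    unfolding partial_deriv_def by (intro DERIV_imp_deriv) (simp add: has_field_derivative_def)
qed

lemma cylindrical_point_eq:
  "cylindrical_point x\<^sub>0 \<theta> \<rho> = axis 0 x\<^sub>0 + (\<rho> * cos \<theta>) *\<^sub>R axis 1 1 + (\<rho> * sin \<theta>) *\<^sub>R axis 2 1"
  unfolding vec_eq_iff forall_3 by (simp add: axis_def cylindrical_point_def)

text \<open>Chain rule along the circle traced by varying the angle: its velocity at
  \<open>x\<close> is \<open>x $ 1 *\<^sub>R axis 2 1 - x $ 2 *\<^sub>R axis 1 1\<close>, and
  \<open>D\<close> is linear.\<close>

lemma angular_deriv_eq_partial_derivs:
  assumes "h differentiable (at (cylindrical_point x\<^sub>0 \<theta> \<rho>))"
  defines "x \<equiv> cylindrical_point x\<^sub>0 \<theta> \<rho>"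
  shows "angular_deriv h x\<^sub>0 \<theta> \<rho> = x $ 1 * partial_deriv 2 h x - x $ 2 * partial_deriv 1 h x"
proof -
  obtain D where D: "(h has_derivative D) (at x)"
    using assms by (auto simp: differentiable_def)
  have "((\<lambda>t. cylindrical_point x\<^sub>0 t \<rho>) has_derivative
      (\<lambda>t. t *\<^sub>R (x $ 1 *\<^sub>R axis 2 1 - x $ 2 *\<^sub>R axis 1 1))) (at \<theta>)"
    \<comment> \<open>The components of \<open>x\<close> are evaluated first, because expanding the
      point into a sum of axis vectors would hide them from
      \<open>cylindrical_point_nth\<close>.\<close>
    unfolding x_def cylindrical_point_nth unfolding cylindrical_point_eq
    by (auto intro!: derivative_eq_intros simp: algebra_simps)
  then have "((\<lambda>t. h (cylindrical_point x\<^sub>0 t \<rho>)) has_derivative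
      (\<lambda>t. D (t *\<^sub>R (x $ 1 *\<^sub>R axis 2 1 - x $ 2 *\<^sub>R axis 1 1)))) (at \<theta>)"
    by (rule has_derivative_compose) (use D x_def in simp)
  moreover have "D (t *\<^sub>R (x $ 1 *\<^sub>R axis 2 1 - x $ 2 *\<^sub>R axis 1 1))
      = (x $ 1 * partial_deriv 2 h x - x $ 2 * partial_deriv 1 h x) * t" for t
    using has_derivative_linear[OF D]
    by (simp add: partial_deriv_eq_derivative[OF D] linear_cmul linear_diff mult.commute)
  ultimately show ?thesis
    unfolding angular_deriv_def
    by (intro DERIV_imp_deriv) (simp add: has_field_derivative_def)
qed

lemma ex_cylindrical_point:
  assumes "axial_radius x > 0"
  obtains x\<^sub>0 \<theta> \<rho> where "\<rho> > 0" "x = cylindrical_point x\<^sub>0 \<theta> \<rho>"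
proof -
  let ?r = "axial_radius x"
  have "(x $ 1)\<^sup>2 + (x $ 2)\<^sup>2 = ?r\<^sup>2"
    by (simp add: axial_radius_def)
  then have "(x $ 1 / ?r)\<^sup>2 + (x $ 2 / ?r)\<^sup>2 = ?r\<^sup>2 / ?r\<^sup>2"
    by (metis power_divide add_divide_distrib)
  then have "(x $ 1 / ?r)\<^sup>2 + (x $ 2 / ?r)\<^sup>2 = 1"
    using assms by simp
  then obtain \<theta> where "x $ 1 / ?r = cos \<theta>" "x $ 2 / ?r = sin \<theta>"
    by (rule sincos_total_2pi)
  then have "x $ 1 = ?r * cos \<theta>" "x $ 2 = ?r * sin \<theta>"
    using assms by (auto simp: field_simps)
  \<comment> \<open>In the index type \<open>3 = 0\<close>, so \<open>x $ 3\<close> is the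
    coordinate along the axis; \<open>forall_3\<close> enumerates the indices as 1, 2, 3.\<close>
  then have "x = cylindrical_point (x $ 3) \<theta> ?r"
    unfolding vec_eq_iff forall_3 by (simp add: cylindrical_point_def)
  then show thesis
    using that assms by blast
qed

text \<open>The complement of the hyperplane is dense: a point on it is the limit of points of
  \<open>S\<close> reached by moving along the normal \<open>axis i 1\<close>.\<close>

lemma continuous_on_eq_0_if_eq_0_off_hyperplane:
  fixes g :: "real ^ 'n \<Rightarrow> 'a::{t2_space, zero}"
  assumes "open S" "continuous_on S g"
    and off: "\<And>y. y \<in> S \<Longrightarrow> y $ i \<noteq> 0 \<Longrightarrow> g y = 0"
    and "x \<in> S"
  shows "g x = 0"
proof (cases "x $ i = 0")
  case True
  let ?p = "\<lambda>t::real. x + t *\<^sub>R axis i 1"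
  have p: "(?p \<longlongrightarrow> x) (at 0)"
    by (auto intro!: tendsto_eq_intros)
  have "\<forall>\<^sub>F t in at 0. ?p t \<in> S"
    using topological_tendstoD[OF p \<open>open S\<close> \<open>x \<in> S\<close>] .
  moreover have "\<forall>\<^sub>F t in at 0. t \<noteq> (0::real)"
    by (simp add: eventually_at_filter)
  \<comment> \<open>As \<open>x $ i = 0\<close>, the \<open>i\<close>-th component of
    \<open>?p t\<close> is \<open>t\<close> itself, so \<open>off\<close> applies.\<close>
  ultimately have "\<forall>\<^sub>F t in at 0. g (?p t) = 0"
    by eventually_elim (use True off in simp)
  then have "((\<lambda>t. g (?p t)) \<longlongrightarrow> 0) (at 0)"
    by (rule tendsto_eventually)
  moreover have "isCont g x"
    using assms by (simp add: continuous_on_eq_continuous_at)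
  then have "((\<lambda>t. g (?p t)) \<longlongrightarrow> g x) (at 0)"
    using p by (rule isCont_tendsto_compose)
  ultimately show ?thesis
    using tendsto_unique[OF at_neq_bot] by blast
qed (use assms in simp)

theorem proposition5p1:
  fixes \<alpha> :: real and \<Lambda> :: "(real ^ 3) set" and h :: "real ^ 3 \<Rightarrow> real"
  assumes "\<alpha> > 0"
    and "open \<Lambda>" and "simply_connected \<Lambda>"
    and "\<Lambda> \<subseteq> {x. x $ 2 > 0}"
    and "hyperbolic_harmonic_potential \<alpha> \<Lambda> h"
  shows "axial_hyperbolic_harmonic_potential \<alpha> \<Lambda> h \<longleftrightarrow>
    (\<forall>x\<^sub>0 \<theta> \<rho>. \<rho> > 0 \<longrightarrow> cylindrical_point x\<^sub>0 \<theta> \<rho> \<in> \<Lambda> \<longrightarrow> angular_deriv h x\<^sub>0 \<theta> \<rho> = 0)"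
proof -
  \<comment> \<open>The angular derivative in Cartesian form, whose continuity on \<Lambda> follows
    from that of the first partial derivatives.\<close>
  define g where "g x = x $ 1 * partial_deriv 2 h x - x $ 2 * partial_deriv 1 h x" for x
  have C2: "C2_on \<Lambda> h"
    and eq: "\<And>x. x \<in> \<Lambda> \<Longrightarrow> x $ 2 * laplacian h x = \<alpha> * partial_deriv 2 h x"
    using assms(5) by (auto simp: hyperbolic_harmonic_potential_def)
  have pos: "x $ 2 > 0" if "x \<in> \<Lambda>" for x
    using assms(4) that by auto
  have radius: "axial_radius x > 0" if "x \<in> \<Lambda>" for x
    using pos[OF that] by (simp add: axial_radius_def add_nonneg_pos)
  have diff: "h differentiable (at x)" if "x \<in> \<Lambda>" for x
    using C2 \<open>open \<Lambda>\<close> that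
    by (auto simp: C2_on_def C1_on_def differentiable_on_eq_differentiable_at)
  have cont: "continuous_on \<Lambda> g"
    unfolding g_def using C2
    by (intro continuous_intros) (auto simp: C2_on_def C1_on_def)

  have axial_iff: "((x $ 1)\<^sup>2 + (x $ 2)\<^sup>2) * laplacian h x
      - \<alpha> * (x $ 1 * partial_deriv 1 h x + x $ 2 * partial_deriv 2 h x) = 0
      \<longleftrightarrow> x $ 1 * g x = 0" (is "?A = 0 \<longleftrightarrow> _") if "x \<in> \<Lambda>" for x
  proof -
    have "x $ 2 * ?A = ((x $ 1)\<^sup>2 + (x $ 2)\<^sup>2) * (x $ 2 * laplacian h x)
        - x $ 2 * \<alpha> * (x $ 1 * partial_deriv 1 h x + x $ 2 * partial_deriv 2 h x)"
      by (simp add: algebra_simps)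
    \<comment> \<open>After \<open>eq\<close> is inserted, the two terms with
      \<open>(x $ 2)\<^sup>2 * partial_deriv 2 h x\<close> cancel, and \<open>x $ 1\<close> factors
      out of the rest.\<close>
    also have "\<dots> = \<alpha> * (x $ 1 * g x)"
      unfolding eq[OF that] g_def by (simp add: algebra_simps power2_eq_square)
    finally show ?thesis
      using pos[OF that] \<open>\<alpha> > 0\<close> by (metis mult_eq_0_iff less_irrefl)
  qed

  have "axial_hyperbolic_harmonic_potential \<alpha> \<Lambda> h \<longleftrightarrow> (\<forall>x\<in>\<Lambda>. x $ 1 * g x = 0)"
    using assms(1-3) C2 radius axial_iff
    by (auto simp: axial_hyperbolic_harmonic_potential_def)
  \<comment> \<open>This equivalence is not pointwise: where \<open>x $ 1 = 0\<close>, the value of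
    \<open>g\<close> is determined by its values nearby.\<close>
  also have "\<dots> \<longleftrightarrow> (\<forall>x\<in>\<Lambda>. g x = 0)"
    using continuous_on_eq_0_if_eq_0_off_hyperplane[OF \<open>open \<Lambda>\<close> cont, of 1] by auto
  also have "\<dots> \<longleftrightarrow>
      (\<forall>x\<^sub>0 \<theta> \<rho>. \<rho> > 0 \<longrightarrow> cylindrical_point x\<^sub>0 \<theta> \<rho> \<in> \<Lambda> \<longrightarrow> g (cylindrical_point x\<^sub>0 \<theta> \<rho>) = 0)"
    using ex_cylindrical_point radius by metis
  also have "\<dots> \<longleftrightarrow>
      (\<forall>x\<^sub>0 \<theta> \<rho>. \<rho> > 0 \<longrightarrow> cylindrical_point x\<^sub>0 \<theta> \<rho> \<in> \<Lambda> \<longrightarrow> angular_deriv h x\<^sub>0 \<theta> \<rho> = 0)"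
    using angular_deriv_eq_partial_derivs[OF diff] by (simp add: g_def)
  finally show ?thesis .
qed

end
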